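(* Let $n$ be a positive integer and let $S\subseteq[n]$ be a non-empty $n$-admissible set with $m=\max(S)$, and let $p_S(x)$ be its peak polynomial. Then $(\Delta^j p_S)(k)>0$ for all integers $1\leq j\leq m-1$ and all integers $k\geq m$, and $(\Delta^m p_S)(x)=0$ identically.
   Context: For a positive integer $n$, $[n]=\{1,\dots,n\}$ and $\mathfrak{S}_n$ is the symmetric group, with $\pi\in\mathfrak{S}_n$ written in one-line notation $\pi=\pi_1\pi_2\cdots\pi_n$. A permutation $\pi$ has a peak at index $i$ (necessarily $2\le i\le n-1$) if $\pi_{i-1}<\pi_i>\pi_{i+1}$; $\mathcal{P}(\pi)$ is the set of indices at which $\pi$ has a peak. For $S\subseteq[n]$, $\mathcal{P}_S(n)=\{\pi\in\mathfrak{S}_n:\mathcal{P}(\pi)=S\}$, and $S$ is called $n$-admissible if $\mathcal{P}_S(n)\neq\emptyset$ (then $S$ is $k$-admissible for every $k\ge n$). By a result of Billey, Burdzy and Sagan, for each set $S$ that is admissible for some $n$ there is a polynomial $p_S(x)$ (the peak polynomial of $S$), of degree $\max(S)-1$ when $S\neq\emptyset$, such that $|\mathcal{P}_S(n)|=p_S(n)\,2^{n-|S|-1}$ for every $n$ for which $S$ is $n$-admissible. The forward difference operator is $(\Delta f)(x)=f(x+1)-f(x)$, with $\Delta^j f=\Delta(\Delta^{j-1}f)$ and $\Delta^0 f=f$. *)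

theory Defs
  imports
    Complex_Main
    "HOL-Combinatorics.Permutations"
    "HOL-Computational_Algebra.Polynomial"
begin

definition peak_set :: "nat \<Rightarrow> (nat \<Rightarrow> nat) \<Rightarrow> nat set" where
  "peak_set n \<pi> = {i. 2 \<le> i \<and> i \<le> n - 1 \<and> \<pi> (i - 1) < \<pi> i \<and> \<pi> i > \<pi> (i + 1)}"

definition perms_with_peaks :: "nat set \<Rightarrow> nat \<Rightarrow> (nat \<Rightarrow> nat) set" where
  "perms_with_peaks S n = {\<pi>. \<pi> permutes {1..n} \<and> peak_set n \<pi> = S}"

definition admissible :: "nat \<Rightarrow> nat set \<Rightarrow> bool" where
  "admissible n S \<longleftrightarrow> n \<ge> 1 \<and> S \<subseteq> {1..n} \<and> perms_with_peaks S n \<noteq> {}"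

(* Peaks are interior and never adjacent, so an n-admissible set has 2 |S| \<le> n - 1 and the
   natural-number subtraction in the exponent is exact. An admissible set is k-admissible for all
   large k, so the counts determine the polynomial. For a set that is never admissible
   the description is not meaningful. *)
definition peak_poly :: "nat set \<Rightarrow> real poly" where
  "peak_poly S = (THE p. \<forall>n. admissible n S \<longrightarrow>
     real (card (perms_with_peaks S n)) = poly p (real n) * 2 ^ (n - card S - 1))"

definition fwd_diff :: "(real \<Rightarrow> real) \<Rightarrow> real \<Rightarrow> real" where
  "fwd_diff f = (\<lambda>x. f (x + 1) - f x)"

end

theory Submission
  imports Defs
begin

text \<open>
Deleting the letter \<open>n + 1\<close> from a permutation of \<open>[n + 1]\<close> with peak set \<open>S\<close>, and recording what
happens to the peaks according to its position, expresses the number of such permutations by the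
numbers for \<open>[n]\<close>, with only positive coefficients. Dividing by the powers of two turns this into a
formula for \<open>\<Delta> p\<^sub>S\<close> as a nonnegative combination of peak polynomials of sets with smaller
maximum; with \<open>p\<^sub>S(m) = 0\<close> it also yields the existence of \<open>p\<^sub>S\<close>. Everything then follows by
induction on \<open>m\<close>. For strictness one needs, when \<open>m > 2\<close>, an admissible set with maximum \<open>m - 1\<close> in the combination: decrement all
elements of \<open>S\<close>, leaving out the element \<open>2\<close> if it is there.
\<close>

subsection \<open>Inserting the largest letter\<close>

text \<open>These turn out to be exactly the sets that are admissible for some \<open>n\<close>.\<close>

definition gapped :: "nat set \<Rightarrow> bool" where
  "gapped S \<longleftrightarrow> finite S \<and> 0 \<notin> S \<and> 1 \<notin> S \<and> (\<forall>x\<in>S. Suc x \<notin> S)"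

text \<open>\<open>pull S t\<close> decrements the elements of \<open>S\<close> that are at least \<open>t\<close> (for \<open>0 \<notin> S\<close>).\<close>

definition pull :: "nat set \<Rightarrow> nat \<Rightarrow> nat set" where
  "pull S t = {i. i \<in> S \<and> i < t \<or> Suc i \<in> S \<and> t \<le> Suc i}"

text \<open>\<open>push n k P\<close> is the peak set after inserting \<open>n + 1\<close> at position \<open>k\<close> into a permutation of \<open>[n]\<close>
with peak set \<open>P\<close>; \<open>\<sigma> \<circ> skip n k\<close> deletes the letter at position \<open>k\<close> of \<open>\<sigma>\<close>.\<close>

definition push :: "nat \<Rightarrow> nat \<Rightarrow> nat set \<Rightarrow> nat set" where
  "push n k P = {i. i \<in> P \<and> Suc i < k \<or> i = k \<and> 2 \<le> k \<and> k \<le> n \<or> Suc k < i \<and> i - 1 \<in> P}"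

definition skip :: "nat \<Rightarrow> nat \<Rightarrow> nat \<Rightarrow> nat" where
  "skip n k i = (if i = Suc n then k else if k \<le> i \<and> i \<le> n then Suc i else i)"

definition peak_count :: "nat set \<Rightarrow> nat \<Rightarrow> nat" where
  "peak_count S n = card (perms_with_peaks S n)"

lemma gapped_peak_set: "gapped (peak_set n \<pi>)"
proof -
  have "peak_set n \<pi> \<subseteq> {..n}" by (auto simp: peak_set_def)
  then have "finite (peak_set n \<pi>)" by (rule finite_subset) simp
  then show ?thesis by (auto simp: gapped_def peak_set_def)
qed

lemma gapped_subset: "gapped S \<Longrightarrow> T \<subseteq> S \<Longrightarrow> gapped T"
  unfolding gapped_def by (meson finite_subset subsetD)

lemma gapped_ge_2: "gapped S \<Longrightarrow> x \<in> S \<Longrightarrow> 2 \<le> x"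
  unfolding gapped_def by (metis One_nat_def less_2_cases not_le)

lemma finite_perms_with_peaks: "finite (perms_with_peaks S n)"
  unfolding perms_with_peaks_def
  by (rule finite_subset[OF _ finite_permutations[of "{1..n}"]]) auto

lemma peak_count_not_gapped: "\<not> gapped S \<Longrightarrow> peak_count S n = 0"
  using gapped_peak_set
  by (metis (mono_tags, lifting) card.empty empty_Collect_eq peak_count_def perms_with_peaks_def)

text \<open>Peaks are interior, so a peak at \<open>m\<close> forces \<open>n > m\<close>. The case
  \<open>n = m\<close> supplies the initial value zero of the recurrence.\<close>

lemma peak_count_eq_0: "m \<in> S \<Longrightarrow> n \<le> m \<Longrightarrow> n \<ge> 1 \<Longrightarrow> peak_count S n = 0"
proof -
  assume "m \<in> S" "n \<le> m" "n \<ge> 1"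
  then have "perms_with_peaks S n = {}"
    by (auto simp: perms_with_peaks_def peak_set_def)
  then show ?thesis by (simp add: peak_count_def)
qed

lemma skip_permutes:
  assumes "k \<in> {1..Suc n}"
  shows "skip n k permutes {1..Suc n}"
proof (rule bij_imp_permutes)
  show "bij_betw (skip n k) {1..Suc n} {1..Suc n}"
    by (rule bij_betw_byWitness[where f' = "\<lambda>i. if i = k then Suc n else if k < i then i - 1 else i"])
      (use assms in \<open>auto simp: skip_def\<close>)
qed (use assms in \<open>auto simp: skip_def\<close>)

lemma bij_betw_delete_max:
  assumes k: "k \<in> {1..Suc n}"
  shows "bij_betw (\<lambda>\<sigma>. \<sigma> \<circ> skip n k)
    {\<sigma>. \<sigma> permutes {1..Suc n} \<and> \<sigma> k = Suc n} {\<pi>. \<pi> permutes {1..n}}"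
proof (rule bij_betw_byWitness[where f' = "\<lambda>\<pi>. \<pi> \<circ> inv (skip n k)"])
  note p = skip_permutes[OF k]
  have sk: "skip n k (Suc n) = k" by (simp add: skip_def)
  then have isk: "inv (skip n k) k = Suc n"
    using permutes_inv_eq[OF p] by blast
  show "\<forall>\<sigma>\<in>{\<sigma>. \<sigma> permutes {1..Suc n} \<and> \<sigma> k = Suc n}. (\<sigma> \<circ> skip n k) \<circ> inv (skip n k) = \<sigma>"
    using permutes_inv_o[OF p] by (simp add: comp_assoc)
  show "\<forall>\<pi>\<in>{\<pi>. \<pi> permutes {1..n}}. (\<pi> \<circ> inv (skip n k)) \<circ> skip n k = \<pi>"
    using permutes_inv_o[OF p] by (simp add: comp_assoc)
  show "(\<lambda>\<sigma>. \<sigma> \<circ> skip n k) ` {\<sigma>. \<sigma> permutes {1..Suc n} \<and> \<sigma> k = Suc n} \<subseteq> {\<pi>. \<pi> permutes {1..n}}"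
  proof clarsimp
    fix \<sigma> assume s: "\<sigma> permutes {Suc 0..Suc n}" "\<sigma> k = Suc n"
    then have "(\<sigma> \<circ> skip n k) permutes {1..Suc n}"
      using permutes_compose[OF p] by simp
    then show "(\<sigma> \<circ> skip n k) permutes {Suc 0..n}"
      \<comment> \<open>Since \<open>skip n k\<close> sends \<open>n + 1\<close> to
        \<open>k\<close>, the composite fixes \<open>n + 1\<close> and hence permutes the smaller
        interval.\<close>
      by (rule permutes_superset) (use s sk in \<open>auto simp: le_Suc_eq\<close>)
  qed
  show "(\<lambda>\<pi>. \<pi> \<circ> inv (skip n k)) ` {\<pi>. \<pi> permutes {1..n}} \<subseteq> {\<sigma>. \<sigma> permutes {1..Suc n} \<and> \<sigma> k = Suc n}"
  proof clarsimp
    fix \<pi> assume s: "\<pi> permutes {Suc 0..n}"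
    then have "\<pi> permutes {1..Suc n}" by (rule permutes_subset) auto
    moreover have "\<pi> (Suc n) = Suc n" using s by (rule permutes_not_in) simp
    ultimately show "\<pi> \<circ> inv (skip n k) permutes {Suc 0..Suc n} \<and> \<pi> (inv (skip n k) k) = Suc n"
      using permutes_compose[OF permutes_inv[OF p]] isk by simp
  qed
qed

text \<open>The largest letter is a peak wherever it is interior and prevents peaks on either side
  of it. Elsewhere the three compared letters stay the same, with indices beyond \<open>k\<close>
  moved by one.\<close>

lemma peak_set_delete_max:
  assumes \<sigma>: "\<sigma> permutes {1..Suc n}" "\<sigma> k = Suc n" and k: "k \<in> {1..Suc n}"
  shows "peak_set (Suc n) \<sigma> = push n k (peak_set n (\<sigma> \<circ> skip n k))"
proof (rule set_eqI)
  fix i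
  have lt: "\<sigma> j < \<sigma> k" if "j \<in> {1..Suc n}" "j \<noteq> k" for j
    using that permutes_in_image[OF \<sigma>(1), of j] permutes_inj[OF \<sigma>(1)] \<sigma>(2)
    by (metis atLeastAtMost_iff injD order_le_neq_trans)
  have lo: "skip n k j = j" if "j < k" "j \<le> n" for j
    using that by (simp add: skip_def)
  have hi: "skip n k j = Suc j" if "k \<le> j" "j \<le> n" for j
    using that by (simp add: skip_def)
  consider "Suc i < k" | "Suc i = k" | "i = k" | "i = Suc k" | "Suc k < i" by linarith
  then show "i \<in> peak_set (Suc n) \<sigma> \<longleftrightarrow> i \<in> push n k (peak_set n (\<sigma> \<circ> skip n k))"
  proof cases
    case 1
    then show ?thesis using k by (auto simp: peak_set_def push_def lo)
  next
    case 2
    then have "i \<notin> peak_set (Suc n) \<sigma>"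
      using lt[of i] by (auto simp: peak_set_def)
    then show ?thesis using 2 by (auto simp: push_def)
  next
    case 3
    then show ?thesis
      using lt[of "i - 1"] lt[of "Suc i"] by (cases i) (auto simp: peak_set_def push_def)
  next
    case 4
    then have "i \<notin> peak_set (Suc n) \<sigma>"
      using lt[of i] by (auto simp: peak_set_def)
    then show ?thesis using 4 by (auto simp: push_def)
  next
    case 5
    then obtain j where j: "i = Suc j" "k < j" by (cases i) auto
    then show ?thesis using k
      by (cases "j < n") (auto simp: peak_set_def push_def hi Suc_le_eq)
  qed
qed

lemma card_fiber_max:
  assumes k: "k \<in> {1..Suc n}"
  shows "card {\<sigma> \<in> perms_with_peaks S (Suc n). \<sigma> k = Suc n} =
    card {\<pi>. \<pi> permutes {1..n} \<and> push n k (peak_set n \<pi>) = S}"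
proof -
  have "bij_betw (\<lambda>\<sigma>. \<sigma> \<circ> skip n k)
    {\<sigma> \<in> {\<sigma>. \<sigma> permutes {1..Suc n} \<and> \<sigma> k = Suc n}. peak_set (Suc n) \<sigma> = S}
    {\<pi> \<in> {\<pi>. \<pi> permutes {1..n}}. push n k (peak_set n \<pi>) = S}"
    by (rule bij_betw_Collect[OF bij_betw_delete_max[OF k]]) (use peak_set_delete_max[OF _ _ k] in auto)
  then have "card {\<sigma> \<in> {\<sigma>. \<sigma> permutes {1..Suc n} \<and> \<sigma> k = Suc n}. peak_set (Suc n) \<sigma> = S} =
    card {\<pi> \<in> {\<pi>. \<pi> permutes {1..n}}. push n k (peak_set n \<pi>) = S}"
    by (rule bij_betw_same_card)
  then show ?thesis by (simp add: perms_with_peaks_def conj_assoc conj_commute conj_left_commute)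
qed

text \<open>Prepending the largest letter creates no peak and moves all others one place to the
  right. As gapped sets avoid 0 and 1, this can be undone without loss.\<close>

lemma push_first:
  assumes S: "gapped S" and P: "gapped P"
  shows "push n 1 P = S \<longleftrightarrow> P = pull S 1"
proof -
  have eq: "A = B \<longleftrightarrow> (0 \<in> A \<longleftrightarrow> 0 \<in> B) \<and> (1 \<in> A \<longleftrightarrow> 1 \<in> B) \<and> (\<forall>j. Suc (Suc j) \<in> A \<longleftrightarrow> Suc (Suc j) \<in> B)"
    for A B :: "nat set"
    unfolding set_eq_iff by (metis One_nat_def not0_implies_Suc)
  have push: "0 \<notin> push n 1 P" "1 \<notin> push n 1 P" "\<And>j. Suc (Suc j) \<in> push n 1 P \<longleftrightarrow> Suc j \<in> P"
    using P by (auto simp: push_def gapped_def intro!: gr0I)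
  have pull: "i \<in> pull S 1 \<longleftrightarrow> Suc i \<in> S" for i
    using S by (auto simp: pull_def gapped_def)
  have "push n 1 P = S \<longleftrightarrow> (\<forall>j. Suc j \<in> P \<longleftrightarrow> Suc (Suc j) \<in> S)"
    using S unfolding eq[of _ S] by (simp add: push gapped_def del: One_nat_def)
  also have "\<dots> \<longleftrightarrow> P = pull S 1"
    unfolding set_eq_iff pull using S P by (metis One_nat_def gapped_def not0_implies_Suc)
  finally show ?thesis .
qed

lemma push_last: "P \<subseteq> {..<n} \<Longrightarrow> push n (Suc n) P = P"
  by (auto simp: push_def)

text \<open>The three cases are: \<open>k - 1\<close> is a peak, \<open>k\<close> is a peak, neither is.\<close>

lemma push_peak:
  assumes S: "gapped S" and P: "gapped P" and k: "k \<in> S" "k \<le> n"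
  shows "push n k P = S \<longleftrightarrow> P = pull S k \<or> P = pull S (Suc k) \<or> P = pull (S - {k}) k"
proof -
  have k2: "2 \<le> k" using gapped_ge_2[OF S k(1)] .
  then obtain l where l: "k = Suc l" by (cases k) auto
  have nS: "Suc k \<notin> S" "l \<notin> S" and nP: "\<not> (l \<in> P \<and> k \<in> P)"
    using S P k l unfolding gapped_def by auto
  \<comment> \<open>\<open>push\<close> ignores whether \<open>k - 1\<close> and \<open>k\<close>
    lie in \<open>P\<close>, so the equation prescribes \<open>P\<close> only away from these two
    places. A gapped \<open>P\<close> contains at most one of them, which leaves three
    choices.\<close>
  let ?Q = "(\<forall>i<l. i \<in> P \<longleftrightarrow> i \<in> S) \<and> (\<forall>i>k. i \<in> P \<longleftrightarrow> Suc i \<in> S)"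
  have "push n k P = S \<longleftrightarrow> ?Q"
  proof
    assume eq: "push n k P = S"
    show ?Q using k k2 l by (auto simp: push_def eq[symmetric])
  next
    assume Q: ?Q
    show "push n k P = S"
    proof (rule set_eqI)
      fix i
      consider "i < l" | "i = l" | "i = k" | "i = Suc k" | j where "i = Suc j" "k < j"
        unfolding l by (metis Suc_lessE linorder_less_linear not_less_eq)
      then show "i \<in> push n k P \<longleftrightarrow> i \<in> S"
        by cases (use Q k k2 nS l in \<open>auto simp: push_def\<close>)
    qed
  qed
  also have "?Q \<longleftrightarrow> P = pull S k \<or> P = pull S (Suc k) \<or> P = pull (S - {k}) k"
  proof
    assume Q: ?Q
    have split: "P = R" if "\<And>i. i < l \<Longrightarrow> i \<in> R \<longleftrightarrow> i \<in> S" "\<And>i. k < i \<Longrightarrow> i \<in> R \<longleftrightarrow> Suc i \<in> S"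
      "l \<in> P \<longleftrightarrow> l \<in> R" "k \<in> P \<longleftrightarrow> k \<in> R" for R
    proof (rule set_eqI)
      fix i
      consider "i < l" | "i = l" | "i = k" | "k < i" unfolding l by linarith
      then show "i \<in> P \<longleftrightarrow> i \<in> R" by cases (use Q that in auto)
    qed
    consider "l \<in> P" "k \<notin> P" | "k \<in> P" "l \<notin> P" | "k \<notin> P" "l \<notin> P" using nP by blast
    then show "P = pull S k \<or> P = pull S (Suc k) \<or> P = pull (S - {k}) k"
    proof cases
      case 1
      then have "P = pull S k" by (intro split) (use k nS l in \<open>auto simp: pull_def\<close>)
      then show ?thesis by blast
    next
      case 2
      then have "P = pull S (Suc k)" by (intro split) (use k nS l in \<open>auto simp: pull_def\<close>)
      then show ?thesis by blast
    next
      case 3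
      then have "P = pull (S - {k}) k" by (intro split) (use k nS l in \<open>auto simp: pull_def\<close>)
      then show ?thesis by blast
    qed
  next
    assume "P = pull S k \<or> P = pull S (Suc k) \<or> P = pull (S - {k}) k"
    then show ?Q using l by (auto simp: pull_def)
  qed
  finally show ?thesis .
qed

lemma pulls_distinct:
  assumes "gapped S" "k \<in> S"
  shows "pull S k \<noteq> pull S (Suc k)" "pull S k \<noteq> pull (S - {k}) k"
    "pull S (Suc k) \<noteq> pull (S - {k}) k"
proof -
  have nS: "Suc k \<notin> S" using assms by (auto simp: gapped_def)
  then have "k \<notin> pull S k" "k \<in> pull S (Suc k)" "k \<notin> pull (S - {k}) k"
    using assms(2) by (auto simp: pull_def)
  moreover obtain l where l: "k = Suc l" using assms by (cases k) (auto simp: gapped_def)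
  moreover have "l \<in> pull S k" "l \<notin> pull (S - {k}) k"
    using assms l by (auto simp: pull_def gapped_def)
  ultimately show "pull S k \<noteq> pull S (Suc k)" "pull S k \<noteq> pull (S - {k}) k"
    "pull S (Suc k) \<noteq> pull (S - {k}) k" by metis+
qed

text \<open>Permutations are sorted by the position of \<open>n + 1\<close>. The last position gives
  \<open>S\<close> itself, the first gives the shift at 1, and a position \<open>k\<close> in
  \<open>S\<close> gives the shifts at \<open>k\<close> and \<open>k + 1\<close> together with the
  case where the peak at \<open>k\<close> is new.\<close>

lemma peak_count_Suc:
  assumes S: "gapped S" "S \<subseteq> {..n}" and n: "n \<ge> 1"
  shows "peak_count S (Suc n) = peak_count S n
    + (\<Sum>t\<in>insert 1 (S \<union> Suc ` S). peak_count (pull S t) n)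
    + (\<Sum>x\<in>S. peak_count (pull (S - {x}) x) n)"
proof -
  define F where "F k = {\<sigma> \<in> perms_with_peaks S (Suc n). \<sigma> k = Suc n}" for k
  define G where "G k = {\<pi>. \<pi> permutes {1..n} \<and> push n k (peak_set n \<pi>) = S}" for k
  have fin: "finite S" and S01: "0 \<notin> S" "1 \<notin> S" using S by (auto simp: gapped_def)
  have finF: "finite (F k)" for k
    unfolding F_def using finite_perms_with_peaks by simp
  have FG: "card (F k) = card (G k)" if "k \<in> {1..Suc n}" for k
    unfolding F_def G_def by (rule card_fiber_max[OF that])
  have "perms_with_peaks S (Suc n) = (\<Union>k\<in>{1..Suc n}. F k)"
  proof -
    have "\<exists>k\<in>{1..Suc n}. \<sigma> k = Suc n" if "\<sigma> permutes {1..Suc n}" for \<sigma>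
      using permutes_image[OF that] by (metis atLeastAtMost_iff imageE le_add1 le_refl plus_1_eq_Suc)
    then show ?thesis by (auto simp: F_def perms_with_peaks_def)
  qed
  then have "peak_count S (Suc n) = card (\<Union>k\<in>{1..Suc n}. F k)"
    by (simp add: peak_count_def)
  also have "\<dots> = (\<Sum>k\<in>{1..Suc n}. card (F k))"
  proof (rule card_UN_disjoint)
    show "\<forall>i\<in>{1..Suc n}. \<forall>j\<in>{1..Suc n}. i \<noteq> j \<longrightarrow> F i \<inter> F j = {}"
      by (auto simp: F_def perms_with_peaks_def) (metis permutes_def)
  qed (use finF in auto)
  also have "\<dots> = (\<Sum>k\<in>{1..Suc n}. card (G k))"
    by (rule sum.cong) (use FG in auto)
  also have "\<dots> = (\<Sum>k\<in>insert 1 (insert (Suc n) S). card (G k))"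
  proof (rule sum.mono_neutral_right)
    show "\<forall>k\<in>{1..Suc n} - insert 1 (insert (Suc n) S). card (G k) = 0"
    proof
      fix k assume k: "k \<in> {1..Suc n} - insert 1 (insert (Suc n) S)"
      \<comment> \<open>An interior position of the largest letter is a peak, so only positions in
        \<open>S\<close> and the two ends contribute.\<close>
      then have "k \<in> push n k P" for P by (auto simp: push_def)
      then have "G k = {}" using k by (auto simp: G_def)
      then show "card (G k) = 0" by simp
    qed
    show "insert 1 (insert (Suc n) S) \<subseteq> {1..Suc n}"
    proof -
      have "S \<subseteq> {1..n}" using S(2) S01 by (auto simp: Suc_le_eq intro!: gr0I)
      then show ?thesis by auto
    qed
  qed auto
  also have "\<dots> = card (G 1) + (card (G (Suc n)) + (\<Sum>k\<in>S. card (G k)))"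
  proof -
    have "1 \<notin> insert (Suc n) S" "Suc n \<notin> S" using n S01 S(2) by auto
    then show ?thesis using fin by simp
  qed
  also have "card (G 1) = peak_count (pull S 1) n"
    unfolding G_def peak_count_def perms_with_peaks_def
    using push_first[OF S(1) gapped_peak_set] by simp
  also have "card (G (Suc n)) = peak_count S n"
  proof -
    have "peak_set n \<pi> \<subseteq> {..<n}" for \<pi> by (auto simp: peak_set_def)
    then show ?thesis
      unfolding G_def peak_count_def perms_with_peaks_def by (simp add: push_last)
  qed
  also have "(\<Sum>k\<in>S. card (G k)) = (\<Sum>k\<in>S. peak_count (pull S k) n + peak_count (pull S (Suc k)) n
      + peak_count (pull (S - {k}) k) n)"
  proof (rule sum.cong)
    fix k assume k: "k \<in> S"
    have "G k = perms_with_peaks (pull S k) n \<union> perms_with_peaks (pull S (Suc k)) n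
        \<union> perms_with_peaks (pull (S - {k}) k) n"
      using push_peak[OF S(1) gapped_peak_set k, of n n] k S(2)
      unfolding G_def perms_with_peaks_def by auto
    moreover have "perms_with_peaks A n \<inter> perms_with_peaks B n = {}" if "A \<noteq> B" for A B
      using that by (auto simp: perms_with_peaks_def)
    ultimately show "card (G k) = peak_count (pull S k) n + peak_count (pull S (Suc k)) n
      + peak_count (pull (S - {k}) k) n"
      using pulls_distinct[OF S(1) k] unfolding peak_count_def
      by (simp add: card_Un_disjoint finite_perms_with_peaks Int_Un_distrib2)
  qed simp
  also have "\<dots> = (\<Sum>k\<in>S. peak_count (pull S k) n) + (\<Sum>k\<in>Suc ` S. peak_count (pull S k) n)
      + (\<Sum>k\<in>S. peak_count (pull (S - {k}) k) n)"
    by (simp add: sum.distrib sum.reindex)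
  \<comment> \<open>Both families of shifts merge into one sum because a gapped set is disjoint from
    its set of successors.\<close>
  also have "(\<Sum>k\<in>S. peak_count (pull S k) n) + (\<Sum>k\<in>Suc ` S. peak_count (pull S k) n)
      = (\<Sum>k\<in>S \<union> Suc ` S. peak_count (pull S k) n)"
    by (rule sum.union_disjoint[symmetric]) (use S(1) in \<open>auto simp: gapped_def\<close>)
  finally show ?thesis
    using fin S01 by (subst sum.insert) auto
qed

subsection \<open>The recurrence for peak polynomials\<close>

text \<open>The shift by \<open>Suc (Max S)\<close> is excluded because it leaves \<open>S\<close> unchanged.\<close>

definition shifts :: "nat set \<Rightarrow> nat set" where
  "shifts S = insert 1 (S \<union> Suc ` S) - {Suc (Max S)}"

text \<open>This will be the difference of the polynomial of \<open>S\<close>. The factor 1/2 arises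
  because the sets in the first sum have one element more than those in the second, so their power
  of two is half as large.\<close>

definition pull_sum :: "(nat set \<Rightarrow> real) \<Rightarrow> nat set \<Rightarrow> real" where
  "pull_sum f S = (\<Sum>t\<in>shifts S. f (pull S t)) / 2 + (\<Sum>x\<in>S. f (pull (S - {x}) x))"

definition children :: "nat set \<Rightarrow> nat set set" where
  "children S = pull S ` shifts S \<union> (\<lambda>x. pull (S - {x}) x) ` S"

text \<open>The range of \<open>n\<close> includes \<open>n = Max S\<close>, and \<open>S\<close>
  may be a set that is never a peak set. The count is zero there, so the recurrence applies without
  any check of admissibility.\<close>

definition is_count_poly :: "nat set \<Rightarrow> real poly \<Rightarrow> bool" where
  "is_count_poly S p \<longleftrightarrow> (\<forall>n\<ge>1. S \<subseteq> {..n} \<longrightarrow>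
     real (peak_count S n) = poly p (real n) * 2 ^ (n - card S - 1))"

definition count_poly :: "nat set \<Rightarrow> real poly" where
  "count_poly S = (SOME p. is_count_poly S p)"

text \<open>Decrementing from \<open>t\<close> on could only merge an element with its predecessor,
  and a gapped set has no two consecutive elements.\<close>

lemma card_pull:
  assumes "gapped S"
  shows "card (pull S t) = card S"
proof -
  have "bij_betw (\<lambda>y. if y < t then y else y - 1) S (pull S t)"
    unfolding bij_betw_def
  proof
    show "inj_on (\<lambda>y. if y < t then y else y - 1) S"
    proof (rule linorder_inj_onI')
      fix x y assume xy: "x \<in> S" "y \<in> S" "x < y"
      then have "y \<noteq> Suc x" "x \<noteq> 0" using assms unfolding gapped_def by metis+
      then show "(if x < t then x else x - 1) \<noteq> (if y < t then y else y - 1)"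
        using xy(3) by auto
    qed
    show "(\<lambda>y. if y < t then y else y - 1) ` S = pull S t"
    proof (intro equalityI subsetI)
      fix i assume "i \<in> (\<lambda>y. if y < t then y else y - 1) ` S"
      then obtain y where y: "y \<in> S" "i = (if y < t then y else y - 1)" by blast
      moreover have "y \<noteq> 0" using y assms unfolding gapped_def by metis
      ultimately show "i \<in> pull S t" by (cases y) (auto simp: pull_def)
    next
      fix i assume "i \<in> pull S t"
      then consider "i \<in> S" "i < t" | "Suc i \<in> S" "t \<le> Suc i" by (auto simp: pull_def)
      then show "i \<in> (\<lambda>y. if y < t then y else y - 1) ` S"
      proof cases
        case 2 then show ?thesis by (intro image_eqI[of _ _ "Suc i"]) auto
      qed (auto intro: image_eqI[of _ _ i])
    qed
  qed
  then show ?thesis by (metis bij_betw_same_card)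
qed

text \<open>A crude bound that makes the natural-number exponent \<open>n - card S - 1\<close>
  exact.\<close>

lemma card_gapped_less:
  assumes "gapped S" "S \<subseteq> {..n}" "n \<ge> 1"
  shows "card S < n"
proof -
  have "S \<subseteq> {2..n}" using assms gapped_ge_2 by auto
  then have "card S \<le> card {2..n}" by (rule card_mono[rotated]) simp
  then show ?thesis using assms(3) by simp
qed

lemma shifts_le:
  assumes "gapped S" "S \<noteq> {}" "t \<in> shifts S"
  shows "t \<le> Max S"
proof -
  have fin: "finite S" using assms(1) by (auto simp: gapped_def)
  have M: "2 \<le> Max S" using gapped_ge_2[OF assms(1) Max_in[OF fin assms(2)]] .
  consider "t = 1" | "t \<in> S" | x where "x \<in> S" "t = Suc x" "x \<noteq> Max S"
    using assms(3) by (auto simp: shifts_def)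
  then show ?thesis
  proof cases
    case 3
    then show ?thesis using Max_ge[OF fin 3(1)] by simp
  qed (use M fin in auto)
qed

text \<open>Every shift starts at or below \<open>Max S\<close>, so the maximum is decremented or
  removed. This drives all the inductions below.\<close>

lemma children_subset:
  assumes S: "gapped S" "S \<noteq> {}" and T: "T \<in> children S"
  shows "T \<subseteq> {..<Max S}"
proof -
  have fin: "finite S" using assms(1) by (auto simp: gapped_def)
  obtain U t where U: "T = pull U t" "U \<subseteq> S" "t \<le> Max S"
  proof -
    consider t where "t \<in> shifts S" "T = pull S t" | x where "x \<in> S" "T = pull (S - {x}) x"
      using T by (auto simp: children_def)
    then show ?thesis
    proof cases
      case 1
      then show ?thesis using shifts_le[OF S] that by blast
    next
      case 2
      then show ?thesis using Max_ge[OF fin] that by blast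
    qed
  qed
  then show ?thesis using Max_ge[OF fin] by (force simp: pull_def)
qed

text \<open>The shift at \<open>Suc (Max S)\<close> returns \<open>S\<close> and gives a second copy
  of its count. The factor 2 matches the growth of the power of two, so what remains describes a
  difference.\<close>

lemma peak_count_Suc_nonempty:
  assumes S: "gapped S" "S \<noteq> {}" "S \<subseteq> {..n}" and n: "n \<ge> 1"
  shows "peak_count S (Suc n) = 2 * peak_count S n
    + (\<Sum>t\<in>shifts S. peak_count (pull S t) n) + (\<Sum>x\<in>S. peak_count (pull (S - {x}) x) n)"
proof -
  have fin: "finite S" using S(1) by (auto simp: gapped_def)
  have eq: "pull S (Suc (Max S)) = S"
    using Max_ge[OF fin] by (force simp: pull_def less_Suc_eq_le)
  have "(\<Sum>t\<in>insert 1 (S \<union> Suc ` S). peak_count (pull S t) n)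
      = peak_count (pull S (Suc (Max S))) n + (\<Sum>t\<in>shifts S. peak_count (pull S t) n)"
    unfolding shifts_def by (rule sum.remove) (use fin S(2) in auto)
  then show ?thesis using peak_count_Suc[OF S(1,3) n] eq by simp
qed

lemma peak_count_Suc_poly:
  assumes S: "gapped S" "S \<noteq> {}" "S \<subseteq> {..n}" and n: "n \<ge> 1"
    and q: "\<And>T. T \<in> children S \<Longrightarrow> is_count_poly T (q T)"
  shows "real (peak_count S (Suc n)) = 2 * real (peak_count S n)
    + 2 ^ (n - card S) * pull_sum (\<lambda>T. poly (q T) (real n)) S"
proof -
  have fin: "finite S" using S(1) by (auto simp: gapped_def)
  have sub: "T \<subseteq> {..n}" if "T \<in> children S" for T
    using children_subset[OF S(1,2) that] Max_in[OF fin S(2)] S(3) by fastforce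
  have q': "real (peak_count T n) = poly (q T) (real n) * 2 ^ (n - card T - 1)"
    if "T \<in> children S" for T
    using q[OF that] sub[OF that] n by (auto simp: is_count_poly_def)
  obtain e where e: "n - card S = Suc e"
    using card_gapped_less[OF S(1,3) n] by (metis Suc_diff_Suc)
  have 1: "real (peak_count (pull S t) n) = poly (q (pull S t)) (real n) * 2 ^ e" if "t \<in> shifts S" for t
    using q'[of "pull S t"] that card_pull[OF S(1)] e by (simp add: children_def)
  have 2: "real (peak_count (pull (S - {x}) x) n) = poly (q (pull (S - {x}) x)) (real n) * 2 ^ Suc e"
    if x: "x \<in> S" for x
  proof -
    have "card (pull (S - {x}) x) = card S - 1"
      using card_pull[OF gapped_subset[OF S(1)], of "S - {x}"] x fin by simp
    moreover have "card S \<noteq> 0" using fin S(2) by simp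
    ultimately have "n - card (pull (S - {x}) x) - 1 = Suc e" using e by simp
    then show ?thesis using q'[of "pull (S - {x}) x"] x by (simp add: children_def)
  qed
  show ?thesis
    unfolding peak_count_Suc_nonempty[OF S n] pull_sum_def e
    by (simp add: 1 2 sum_distrib_left sum_distrib_right field_simps flip: sum_divide_distrib)
qed

lemma poly_eqI_large:
  fixes p q :: "real poly"
  assumes "\<And>n. n \<ge> N \<Longrightarrow> poly p (real n) = poly q (real n)"
  shows "p = q"
proof (rule ccontr)
  assume "p \<noteq> q"
  then have "finite {x. poly (p - q) x = 0}" by (intro poly_roots_finite) simp
  moreover have "real ` {N..} \<subseteq> {x. poly (p - q) x = 0}" using assms by auto
  ultimately have "finite (real ` {N..})" by (rule rev_finite_subset)
  then show False by (simp add: finite_image_iff infinite_Ici)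
qed

lemma is_count_poly_unique:
  assumes "finite S" "is_count_poly S p" "is_count_poly S q"
  shows "p = q"
proof (rule poly_eqI_large)
  \<comment> \<open>Inserting 0 gives the maximum a meaning for empty \<open>S\<close> as
    well.\<close>
  fix n assume n: "n \<ge> Suc (Max (insert 0 S))"
  moreover have "x \<le> Max (insert 0 S)" if "x \<in> S" for x using that assms(1) by simp
  ultimately have "S \<subseteq> {..n}" by fastforce
  then show "poly p (real n) = poly q (real n)"
    using assms(2,3) n unfolding is_count_poly_def
    by (metis Suc_le_D le_add1 mult_right_cancel plus_1_eq_Suc power_not_zero zero_neq_numeral)
qed

section \<open>Antidifferences of polynomials\<close>

lemma monom_antidifference:
  "\<exists>q :: real poly. \<forall>x. poly q (x + 1) - poly q x = x ^ N"
proof (induction N rule: less_induct)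
  case (less N)
  then obtain Q :: "nat \<Rightarrow> real poly" where
    Q: "\<And>k x. k < N \<Longrightarrow> poly (Q k) (x + 1) - poly (Q k) x = x ^ k" by metis
  \<comment> \<open>The binomial expansion of \<open>(x + 1) ^ Suc N - x ^ Suc N\<close> is solved
    for its term in \<open>x ^ N\<close>; the lower powers are replaced by their antidifferences
    from the induction.\<close>
  define q where "q = smult (1 / (real N + 1))
    (monom 1 (Suc N) - (\<Sum>k<N. smult (real (Suc N choose k)) (Q k)))"
  have "poly q (x + 1) - poly q x = x ^ N" for x
  proof -
    have "(x + 1) ^ Suc N = (\<Sum>k\<le>Suc N. real (Suc N choose k) * x ^ k)"
      using binomial_ring[of x 1 "Suc N"] by simp
    also have "\<dots> = x ^ Suc N + (real N + 1) * x ^ N + (\<Sum>k<N. real (Suc N choose k) * x ^ k)"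
      by (simp add: lessThan_Suc_atMost[symmetric])
    finally have "(x + 1) ^ Suc N - x ^ Suc N - (\<Sum>k<N. real (Suc N choose k) * x ^ k)
      = (real N + 1) * x ^ N" by simp
    moreover have "(\<Sum>k<N. real (Suc N choose k) * x ^ k) =
      (\<Sum>k<N. real (Suc N choose k) * poly (Q k) (x + 1)) - (\<Sum>k<N. real (Suc N choose k) * poly (Q k) x)"
      using Q by (simp add: sum_subtractf[symmetric] right_diff_distrib[symmetric])
    ultimately have "(real N + 1) * (poly q (x + 1) - poly q x) = (real N + 1) * x ^ N"
      unfolding q_def poly_smult right_diff_distrib by (simp add: poly_sum poly_monom)
    then show ?thesis by simp
  qed
  then show ?case by blast
qed

lemma poly_antidifference:
  fixes r :: "real poly"
  obtains q where "\<And>x. poly q (x + 1) - poly q x = poly r x"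
proof -
  obtain Q :: "nat \<Rightarrow> real poly" where
    Q: "\<And>k x. poly (Q k) (x + 1) - poly (Q k) x = x ^ k" using monom_antidifference by metis
  define q where "q = (\<Sum>k\<le>degree r. smult (coeff r k) (Q k))"
  have "poly q (x + 1) - poly q x = poly r x" for x
    by (simp add: q_def poly_sum poly_altdef[of r] sum_subtractf[symmetric] right_diff_distrib[symmetric] Q)
  then show ?thesis by (rule that)
qed

section \<open>Existence of the counting polynomials\<close>

lemma count_poly_step:
  assumes S: "gapped S" "S \<noteq> {}" and q: "\<And>T. T \<in> children S \<Longrightarrow> is_count_poly T (q T)"
  obtains p where "is_count_poly S p"
    "\<And>x. poly p (x + 1) - poly p x = pull_sum (\<lambda>T. poly (q T) x) S"
proof -
  have fin: "finite S" using S(1) by (auto simp: gapped_def)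
  let ?M = "Max S"
  have M: "?M \<in> S" "2 \<le> ?M" using Max_in[OF fin S(2)] gapped_ge_2[OF S(1)] by auto
  obtain r where r: "\<And>x. poly r (x + 1) - poly r x = poly (smult (1 / 2)
      (\<Sum>t\<in>shifts S. q (pull S t)) + (\<Sum>x\<in>S. q (pull (S - {x}) x))) x"
    using poly_antidifference by blast
  \<comment> \<open>The free constant of the antidifference is chosen so that \<open>p\<close>
    vanishes at \<open>Max S\<close>, as the count does. From there on both follow the same
    recurrence.\<close>
  define p where "p = r - [:poly r (real ?M):]"
  have diff: "poly p (x + 1) - poly p x = pull_sum (\<lambda>T. poly (q T) x) S" for x
    using r[of x] by (simp add: p_def pull_sum_def poly_sum)
  have "real (peak_count S n) = poly p (real n) * 2 ^ (n - card S - 1)" if "?M \<le> n" for n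
    using that
  proof (induction n rule: dec_induct)
    case base
    then show ?case using peak_count_eq_0[OF M(1)] M(2) by (simp add: p_def)
  next
    case (step n)
    have n: "S \<subseteq> {..n}" "n \<ge> 1" using Max_ge[OF fin] step(1) M(2) by fastforce+
    obtain e where e: "n - card S = Suc e"
      using card_gapped_less[OF S(1) n] by (metis Suc_diff_Suc)
    have "real (peak_count S (Suc n)) = 2 * (poly p (real n) * 2 ^ e)
        + 2 ^ Suc e * (poly p (real n + 1) - poly p (real n))"
      using peak_count_Suc_poly[OF S n q] step.IH e diff by simp
    moreover have "Suc n - card S - 1 = Suc e" using e by simp
    ultimately show ?case by (simp add: algebra_simps)
  qed
  then have "is_count_poly S p"
    unfolding is_count_poly_def using M(1) by blast
  then show ?thesis using diff by (rule that)
qed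

lemma is_count_poly_empty: "is_count_poly {} 1"
proof -
  have "real (peak_count {} n) = 2 ^ (n - 1)" if "1 \<le> n" for n
    using that
  proof (induction n rule: dec_induct)
    case base
    have "perms_with_peaks {} 1 = {id}"
      by (auto simp: perms_with_peaks_def peak_set_def)
    then show ?case by (simp add: peak_count_def)
  next
    case (step n)
    \<comment> \<open>Without peaks the largest letter stands first or last, so the count
      doubles.\<close>
    have "gapped {}" "pull {} 1 = {}" by (auto simp: gapped_def pull_def)
    then show ?case using peak_count_Suc[of "{}" n] step by (cases n) auto
  qed
  then show ?thesis by (simp add: is_count_poly_def)
qed

lemma is_count_poly_not_gapped: "\<not> gapped S \<Longrightarrow> is_count_poly S 0"
  by (simp add: is_count_poly_def peak_count_not_gapped)

text \<open>The bound on the maximum drops on passing to children. A child that is not gapped causes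
  no trouble, since its polynomial is zero.\<close>

lemma ex_is_count_poly: "S \<subseteq> {..M} \<Longrightarrow> \<exists>p. is_count_poly S p"
proof (induction M arbitrary: S)
  case 0
  then have "S = {} \<or> \<not> gapped S" by (auto simp: gapped_def)
  then show ?case using is_count_poly_empty is_count_poly_not_gapped by blast
next
  case (Suc M)
  show ?case
  proof (cases "gapped S \<and> S \<noteq> {}")
    case True
    then have "Max S \<in> S" by (simp add: gapped_def)
    then have "Max S \<le> Suc M" using Suc.prems by auto
    then have "T \<subseteq> {..M}" if "T \<in> children S" for T
      using children_subset[OF _ _ that] True by fastforce
    then have "\<And>T. T \<in> children S \<Longrightarrow> is_count_poly T (SOME p. is_count_poly T p)"
      using Suc.IH by (meson someI_ex)
    then obtain p where "is_count_poly S p"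
      using count_poly_step[of S "\<lambda>T. SOME p. is_count_poly T p"] True by blast
    then show ?thesis ..
  qed (use is_count_poly_empty is_count_poly_not_gapped in blast)
qed

lemma is_count_poly_count_poly: "finite S \<Longrightarrow> is_count_poly S (count_poly S)"
  unfolding count_poly_def
  by (rule someI_ex, rule ex_is_count_poly[of S "Max S"]) (auto intro: Max_ge)

lemma count_poly_eqI: "finite S \<Longrightarrow> is_count_poly S p \<Longrightarrow> count_poly S = p"
  using is_count_poly_count_poly is_count_poly_unique by blast

lemma finite_child: "gapped S \<Longrightarrow> S \<noteq> {} \<Longrightarrow> T \<in> children S \<Longrightarrow> finite T"
  using children_subset finite_subset by blast

text \<open>The polynomial constructed in \<open>count_poly_step\<close> has this difference, and
  uniqueness identifies it with the chosen one.\<close>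

lemma fwd_diff_count_poly:
  assumes S: "gapped S" "S \<noteq> {}"
  shows "fwd_diff (poly (count_poly S)) = (\<lambda>x. pull_sum (\<lambda>T. poly (count_poly T) x) S)"
proof -
  have "finite S" using S(1) by (simp add: gapped_def)
  moreover obtain p where p: "is_count_poly S p"
    "\<And>x. poly p (x + 1) - poly p x = pull_sum (\<lambda>T. poly (count_poly T) x) S"
    using count_poly_step[OF S, of count_poly] is_count_poly_count_poly finite_child[OF S] by metis
  ultimately have "count_poly S = p" by (rule_tac count_poly_eqI)
  then show ?thesis using p(2) by (simp add: fwd_diff_def)
qed

subsection \<open>Iterated differences\<close>

lemma fwd_diff_pull_sum:
  "fwd_diff (\<lambda>x. pull_sum (\<lambda>T. f T x) S) = (\<lambda>x. pull_sum (\<lambda>T. fwd_diff (f T) x) S)"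
  by (simp add: fwd_diff_def pull_sum_def sum_subtractf diff_divide_distrib add_diff_add)

lemma funpow_fwd_diff_pull_sum:
  "(fwd_diff ^^ j) (\<lambda>x. pull_sum (\<lambda>T. f T x) S) = (\<lambda>x. pull_sum (\<lambda>T. (fwd_diff ^^ j) (f T) x) S)"
  by (induction j) (simp_all add: fwd_diff_pull_sum)

lemma funpow_Suc_fwd_diff_count_poly:
  assumes "gapped S" "S \<noteq> {}"
  shows "(fwd_diff ^^ Suc j) (poly (count_poly S))
    = (\<lambda>x. pull_sum (\<lambda>T. (fwd_diff ^^ j) (poly (count_poly T)) x) S)"
  by (simp add: funpow_Suc_right fwd_diff_count_poly[OF assms] funpow_fwd_diff_pull_sum del: funpow.simps)

lemma funpow_fwd_diff_0: "(fwd_diff ^^ j) (\<lambda>x. 0) = (\<lambda>x. 0)"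
  by (induction j) (simp_all add: fwd_diff_def)

lemma funpow_fwd_diff_const: "(fwd_diff ^^ Suc j) (\<lambda>x. c) = (\<lambda>x. 0)"
proof -
  have "fwd_diff (\<lambda>x. c) = (\<lambda>x. 0)" by (simp add: fwd_diff_def)
  then show ?thesis by (simp add: funpow_Suc_right funpow_fwd_diff_0 del: funpow.simps)
qed

lemma count_poly_empty: "poly (count_poly {}) = (\<lambda>x. 1)"
  using count_poly_eqI[OF _ is_count_poly_empty] by auto

lemma count_poly_not_gapped: "finite S \<Longrightarrow> \<not> gapped S \<Longrightarrow> poly (count_poly S) = (\<lambda>x. 0)"
  using count_poly_eqI[OF _ is_count_poly_not_gapped, of S] by (simp add: fun_eq_iff)

text \<open>Each difference replaces \<open>S\<close> by sets of smaller maximum, until only the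
  empty set with constant polynomial 1 is left. The condition \<open>1 \<le> j\<close> provides the
  difference that kills this constant.\<close>

lemma funpow_fwd_diff_count_poly_eq_0:
  "S \<subseteq> {..M} \<Longrightarrow> 1 \<le> j \<Longrightarrow> M \<le> j \<Longrightarrow> (fwd_diff ^^ j) (poly (count_poly S)) = (\<lambda>x. 0)"
proof (induction M arbitrary: S j)
  case (Suc M)
  obtain i where i: "j = Suc i" using Suc.prems by (cases j) auto
  have fin: "finite S" using Suc.prems finite_subset by blast
  show ?case
  proof (cases "gapped S \<and> S \<noteq> {}")
    case True
    then have M: "Max S \<in> S" by (simp add: gapped_def)
    \<comment> \<open>A maximum of at least 2 forces \<open>j\<close> to be at least 2, so a
      difference remains for the children.\<close>
    then have "Max S \<le> Suc M" "2 \<le> Max S" using Suc.prems gapped_ge_2 True by auto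
    then have "(fwd_diff ^^ i) (poly (count_poly T)) = (\<lambda>x. 0)" if "T \<in> children S" for T
      using children_subset[OF _ _ that] True Suc.prems i by (intro Suc.IH) fastforce+
    then have "pull_sum (\<lambda>T. (fwd_diff ^^ i) (poly (count_poly T)) x) S = 0" for x
      by (simp add: pull_sum_def children_def)
    then show ?thesis
      unfolding i using funpow_Suc_fwd_diff_count_poly[of S i] True by simp
  qed (use fin i in \<open>auto simp: count_poly_empty count_poly_not_gapped funpow_fwd_diff_0 funpow_fwd_diff_const
         simp del: funpow.simps\<close>)
next
  case 0
  then obtain i where i: "j = Suc i" by (cases j) auto
  have "S = {} \<or> (finite S \<and> \<not> gapped S)" using 0 finite_subset by (auto simp: gapped_def)
  then show ?case
    by (auto simp: i count_poly_empty count_poly_not_gapped funpow_fwd_diff_0 funpow_fwd_diff_const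
         simp del: funpow.simps)
qed

section \<open>Positivity of the iterated differences\<close>

lemma pull_sum_nonneg:
  "(\<And>T. T \<in> children S \<Longrightarrow> 0 \<le> f T) \<Longrightarrow> 0 \<le> pull_sum f S"
  unfolding pull_sum_def children_def by (intro add_nonneg_nonneg divide_nonneg_nonneg sum_nonneg) auto

lemma pull_sum_pos:
  assumes "finite S" and nn: "\<And>T. T \<in> children S \<Longrightarrow> 0 \<le> f T" and T: "T \<in> children S" "0 < f T"
  shows "0 < pull_sum f S"
proof -
  have "0 \<le> (\<Sum>t\<in>shifts S. f (pull S t))" "0 \<le> (\<Sum>x\<in>S. f (pull (S - {x}) x))"
    using nn by (auto simp: children_def intro!: sum_nonneg)
  moreover have "0 < (\<Sum>t\<in>shifts S. f (pull S t)) \<or> 0 < (\<Sum>x\<in>S. f (pull (S - {x}) x))"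
  proof -
    consider t where "t \<in> shifts S" "T = pull S t" | x where "x \<in> S" "T = pull (S - {x}) x"
      using T(1) by (auto simp: children_def)
    then show ?thesis
    proof cases
      case 1
      then have "0 < (\<Sum>t\<in>shifts S. f (pull S t))"
        using assms by (intro sum_pos2[of _ t]) (auto simp: children_def shifts_def)
      then show ?thesis ..
    next
      case 2
      then have "0 < (\<Sum>x\<in>S. f (pull (S - {x}) x))"
        using assms by (intro sum_pos2[of _ x]) (auto simp: children_def)
      then show ?thesis ..
    qed
  qed
  ultimately show ?thesis unfolding pull_sum_def by linarith
qed

text \<open>Strictness requires one child on which the induction gives a strict bound, so its
  maximum must drop by exactly one. For \<open>Max S = 2\<close> the empty child suffices, because
  only \<open>j = 0\<close> is then asked of it.\<close>

lemma ex_top_child: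
  assumes S: "gapped S" "S \<noteq> {}"
  shows "\<exists>T\<in>children S. gapped T \<and> (Max S = 2 \<or> Max S - 1 \<in> T)"
proof -
  have fin: "finite S" using S(1) by (auto simp: gapped_def)
  obtain M where M: "Max S = Suc M" "Suc M \<in> S" "1 \<le> M"
    using Max_in[OF fin S(2)] gapped_ge_2[OF S(1)] by (cases "Max S") force+
  \<comment> \<open>Decrementing everything keeps the gaps but would turn 2 into the forbidden 1.
    Deleting 2 and shifting there avoids this and is again a child.\<close>
  define T where "T = (if 2 \<in> S then pull (S - {2}) 2 else pull S 1)"
  have T: "T \<in> children S"
  proof (cases "2 \<in> S")
    case True
    then show ?thesis by (auto simp: T_def children_def)
  next
    case False
    have "1 \<in> shifts S" using M by (simp add: shifts_def)
    then show ?thesis using False by (simp add: T_def children_def)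
  qed
  have mem: "i \<in> T \<longleftrightarrow> Suc i \<in> S \<and> i \<noteq> 1" for i
  proof (cases "2 \<in> S")
    case True
    have "i \<notin> S" if "i < 2" using gapped_ge_2[OF S(1)] that by fastforce
    moreover have "2 \<le> Suc i" if "Suc i \<in> S" using gapped_ge_2[OF S(1) that] .
    ultimately show ?thesis using True by (auto simp: T_def pull_def)
  next
    case False
    have "0 \<notin> S" using S(1) by (simp add: gapped_def)
    moreover have "i \<noteq> 1" if "Suc i \<in> S" using False that by (auto simp: numeral_2_eq_2)
    ultimately show ?thesis using False by (auto simp: T_def pull_def)
  qed
  have "gapped T"
    using S(1) finite_child[OF S T] mem unfolding gapped_def by auto
  moreover have "Max S = 2 \<or> Max S - 1 \<in> T" using M mem by auto
  ultimately show ?thesis using T by blast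
qed

lemma count_poly_nonneg:
  assumes "finite S" "n \<ge> 1" "S \<subseteq> {..n}"
  shows "0 \<le> poly (count_poly S) (real n)"
proof -
  have "0 \<le> poly (count_poly S) (real n) * 2 ^ (n - card S - 1)"
    using is_count_poly_count_poly[OF assms(1)] assms(2,3)
    unfolding is_count_poly_def by (metis of_nat_0_le_iff)
  moreover have "(0 :: real) < 2 ^ (n - card S - 1)" by simp
  ultimately show ?thesis by (metis zero_le_mult_iff not_le)
qed

text \<open>The existential expresses that \<open>j\<close> is below the maximum and stays
  meaningful for the empty set. \<open>k\<close> lies strictly beyond \<open>S\<close> because for
  \<open>j = 0\<close> the polynomial of a nonempty gapped set vanishes at its maximum.\<close>

definition positive_differences :: "nat set \<Rightarrow> bool" where
  "positive_differences S \<longleftrightarrow> (\<forall>j k. (\<forall>s\<in>S. s < k) \<longrightarrow>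
     0 \<le> (fwd_diff ^^ j) (poly (count_poly S)) (real k) \<and>
     (gapped S \<and> (j = 0 \<or> (\<exists>s\<in>S. j < s)) \<longrightarrow> 0 < (fwd_diff ^^ j) (poly (count_poly S)) (real k)))"

text \<open>One difference is traded for the children, which lie strictly below
  \<open>Max S\<close>. Hence the bound already holds at \<open>k = Max S\<close>.\<close>

lemma positive_differences_Suc:
  assumes S: "gapped S" "S \<noteq> {}" and ch: "\<And>T. T \<in> children S \<Longrightarrow> positive_differences T"
    and k: "Max S \<le> k"
  shows "0 \<le> (fwd_diff ^^ Suc j) (poly (count_poly S)) (real k)"
    and "Suc j < Max S \<Longrightarrow> 0 < (fwd_diff ^^ Suc j) (poly (count_poly S)) (real k)"
proof -
  have less: "\<forall>s\<in>T. s < k" if "T \<in> children S" for T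
    using children_subset[OF S that] k by auto
  have nn: "0 \<le> (fwd_diff ^^ j) (poly (count_poly T)) (real k)" if "T \<in> children S" for T
    using ch[OF that] less[OF that] by (auto simp: positive_differences_def)
  show "0 \<le> (fwd_diff ^^ Suc j) (poly (count_poly S)) (real k)"
    unfolding funpow_Suc_fwd_diff_count_poly[OF S] using nn by (rule pull_sum_nonneg)
  assume j: "Suc j < Max S"
  obtain T where T: "T \<in> children S" "gapped T" "Max S = 2 \<or> Max S - 1 \<in> T"
    using ex_top_child[OF S] by blast
  then have "j = 0 \<or> (\<exists>s\<in>T. j < s)" using j by fastforce
  then have "0 < (fwd_diff ^^ j) (poly (count_poly T)) (real k)"
    using ch[OF T(1)] less[OF T(1)] T(2) by (auto simp: positive_differences_def)
  then show "0 < (fwd_diff ^^ Suc j) (poly (count_poly S)) (real k)"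
    unfolding funpow_Suc_fwd_diff_count_poly[OF S] using S(1) nn T(1)
    by (intro pull_sum_pos) (auto simp: gapped_def)
qed

lemma positive_differences: "S \<subseteq> {..M} \<Longrightarrow> positive_differences S"
proof (induction M arbitrary: S rule: less_induct)
  case (less M)
  have fin: "finite S" using less.prems finite_subset by blast
  show ?case
  proof (cases "gapped S \<and> S \<noteq> {}")
    case True
    then have S: "gapped S" "S \<noteq> {}" by auto
    then have M: "Max S \<in> S" "2 \<le> Max S" using fin gapped_ge_2 by auto
    have ch: "positive_differences T" if "T \<in> children S" for T
      using children_subset[OF S that] M less.prems by (intro less.IH[of "Max S - 1"]) fastforce+
    note suc = positive_differences_Suc[OF S ch]
    show ?thesis unfolding positive_differences_def
    proof (intro allI impI)
      fix j k assume k: "\<forall>s\<in>S. s < k"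
      then have kM: "Max S < k" using M by blast
      show "0 \<le> (fwd_diff ^^ j) (poly (count_poly S)) (real k) \<and>
        (gapped S \<and> (j = 0 \<or> (\<exists>s\<in>S. j < s)) \<longrightarrow> 0 < (fwd_diff ^^ j) (poly (count_poly S)) (real k))"
      proof (cases j)
        case 0
        \<comment> \<open>The value at \<open>k\<close> is the value at \<open>l = k - 1\<close>,
          nonnegative as a scaled count, plus the first difference at \<open>l\<close>, which is
          positive.\<close>
        obtain l where l: "k = Suc l" "Max S \<le> l" using kM by (cases k) auto
        have "S \<subseteq> {..l}" using Max_ge[OF fin] l(2) by fastforce
        then have "0 \<le> poly (count_poly S) (real l)"
          using count_poly_nonneg[OF fin, of l] M l by simp
        moreover have "0 < fwd_diff (poly (count_poly S)) (real l)"
          using suc(2)[OF _ l(2), of 0] M by simp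
        ultimately show ?thesis
          unfolding 0 l(1) by (simp add: fwd_diff_def add.commute)
      next
        case (Suc i)
        have "Suc i < Max S" if "s \<in> S" "j < s" for s
          using that Max_ge[OF fin that(1)] Suc by simp
        then show ?thesis using suc(1)[of k i] suc(2)[of k i] kM Suc by auto
      qed
    qed
  next
    case False
    show ?thesis
    proof (cases "gapped S")
      case True
      then have "S = {}" using False by simp
      moreover have "0 \<le> (fwd_diff ^^ j) (\<lambda>x. 1) y" for j y
        by (cases j) (simp_all add: funpow_fwd_diff_const del: funpow.simps(2))
      ultimately show ?thesis by (auto simp: positive_differences_def count_poly_empty)
    qed (use fin in \<open>auto simp: positive_differences_def count_poly_not_gapped funpow_fwd_diff_0\<close>)
  qed
qed

section \<open>Identification with the peak polynomial\<close>

lemma peak_poly_eq_count_poly: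
  assumes S: "gapped S"
  shows "peak_poly S = count_poly S"
proof -
  have fin: "finite S" using S by (auto simp: gapped_def)
  note cp = is_count_poly_count_poly[OF fin]
  have pc: "real (card (perms_with_peaks S n)) = poly (count_poly S) (real n) * 2 ^ (n - card S - 1)"
    if "n \<ge> 1" "S \<subseteq> {..n}" for n
    using cp that by (auto simp: is_count_poly_def peak_count_def)
  show ?thesis unfolding peak_poly_def
  proof (rule the_equality)
    show "\<forall>n. admissible n S \<longrightarrow>
      real (card (perms_with_peaks S n)) = poly (count_poly S) (real n) * 2 ^ (n - card S - 1)"
    proof (intro allI impI)
      fix n assume "admissible n S"
      then have "n \<ge> 1" "S \<subseteq> {..n}" by (auto simp: admissible_def)
      then show "real (card (perms_with_peaks S n)) = poly (count_poly S) (real n) * 2 ^ (n - card S - 1)"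
        by (rule pc)
    qed
  next
    fix p assume p: "\<forall>n. admissible n S \<longrightarrow>
      real (card (perms_with_peaks S n)) = poly p (real n) * 2 ^ (n - card S - 1)"
    show "p = count_poly S"
    proof (rule poly_eqI_large)
      fix n assume n: "n \<ge> Suc (Max (insert 0 S))"
      then have less: "\<forall>s\<in>S. s < n" using fin by (auto simp: Suc_le_eq)
      then have sub: "S \<subseteq> {1..n}" using gapped_ge_2[OF S] by fastforce
      have n1: "n \<ge> 1" using n by simp
      \<comment> \<open>The definite description needs infinitely many admissible \<open>n\<close>.
        Positivity with \<open>j = 0\<close> gives them: a gapped set is \<open>n\<close>-admissible
        for every \<open>n\<close> beyond its maximum.\<close>
      have "positive_differences S" using sub by (intro positive_differences[of _ n]) auto
      then have "0 < poly (count_poly S) (real n)"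
        using less S unfolding positive_differences_def by (metis funpow_0)
      then have "0 < real (card (perms_with_peaks S n))" using pc[of n] n1 sub by fastforce
      then have "admissible n S" using n1 sub by (auto simp: admissible_def)
      then show "poly p (real n) = poly (count_poly S) (real n)"
        using p pc[of n] n1 sub by fastforce
    qed
  qed
qed

theorem theorem1:
  fixes n m :: nat and S :: "nat set"
  assumes "n \<ge> 1" and "S \<subseteq> {1..n}" and "S \<noteq> {}" and "admissible n S"
    and "m = Max S"
  shows "(\<forall>j::nat. \<forall>k::int. 1 \<le> j \<and> j \<le> m - 1 \<and> int m \<le> k \<longrightarrow>
           (fwd_diff ^^ j) (poly (peak_poly S)) (of_int k) > 0) \<and>
         (\<forall>x::real. (fwd_diff ^^ m) (poly (peak_poly S)) x = 0)"
proof -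
  obtain \<pi> where "peak_set n \<pi> = S"
    using assms(4) by (auto simp: admissible_def perms_with_peaks_def)
  then have S: "gapped S" using gapped_peak_set by blast
  then have fin: "finite S" by (simp add: gapped_def)
  have m: "m \<in> S" "2 \<le> m" using assms(3,5) fin gapped_ge_2[OF S] by auto
  have sub: "S \<subseteq> {..m}" using assms(5) fin by auto
  have pos: "0 < (fwd_diff ^^ j) (poly (count_poly S)) (of_int k)"
    if jk: "1 \<le> j" "j \<le> m - 1" "int m \<le> k" for j k
  proof -
    \<comment> \<open>As \<open>j\<close> is at least 1, one difference can be passed to the
      children, which reaches the boundary value \<open>k = m\<close>.\<close>
    obtain i where i: "j = Suc i" using jk(1) by (cases j) auto
    have "positive_differences T" if "T \<in> children S" for T
      using children_subset[OF S assms(3) that] by (intro positive_differences[of _ m]) (auto simp: assms(5))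
    then have "0 < (fwd_diff ^^ Suc i) (poly (count_poly S)) (real (nat k))"
      using positive_differences_Suc(2)[OF S assms(3), of "nat k" i] jk i m assms(5) by auto
    then show ?thesis using jk i by simp
  qed
  show ?thesis
    unfolding peak_poly_eq_count_poly[OF S]
    using pos funpow_fwd_diff_count_poly_eq_0[OF sub, of m] m by auto
qed

end
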